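(* Let $p_2,p_{10}\ge 1$ be integers, and consider binary floating-point numbers $2^{E}\cdot m$ with $E$ an integer in a bounded range fixed by the format and with normalized mantissa $m$ in one binade, $2^{p_2-1}\le m<2^{p_2}$. Without loss of generality this binade lies entirely in one decade, so that $\lfloor\log_{10}(m)\rfloor$ has the same value $\ell$ for every $m$ in it. If this is not the case, the mantissas are first scaled by a fixed power of two, the exponent being adjusted so that the value $2^E\cdot m$ is unchanged, so that the scaled binade lies in one decade (for instance, the mantissas may be scaled to $1\le m<2$, where $\ell=0$); $E$ and $m$ then denote the scaled exponent and mantissa. For each exponent $E$ in the (bounded) range put $$m^*(E)=10^{\,1-\left(E\log_{10}(2)-\lfloor E\log_{10}(2)\rfloor\right)+\ell}.$$ Then, for a suitably chosen integer $\lambda$ (fixed for the whole exponent range), for which $\lfloor E\log_{10}(2)\rfloor=\left\lfloor E\left\lfloor\log_{10}(2)\cdot 2^{\lambda}\right\rfloor\cdot 2^{-\lambda}\right\rfloor$ for every $E$ in the range, the decimal exponent $$F=\left\lfloor\log_{10}(2^E\cdot m)\right\rfloor-p_{10}+1$$ is given exactly, for all such $E$ and $m$, by $$F=\left\lfloor E\left\lfloor\log_{10}(2)\cdot 2^{\lambda}\right\rfloor\cdot 2^{-\lambda}\right\rfloor+\lfloor\log_{10}(m)\rfloor-p_{10}+1+\gamma,$$ where $\lfloor\log_{10}(m)\rfloor=\ell$ is a constant, and $\gamma=1$ if $m\ge m^*(E)$ and $\gamma=0$ otherwise.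
   Context: A binary floating-point number is $2^E\cdot m$ with integer exponent $E$ and mantissa $m$, where $p_2$ is the binary precision; before any scaling $m$ is an integer. The integer $p_{10}$ is the precision of the decimal output format. The quantity $F$ is the exponent used when converting $2^E\cdot m$ to a decimal floating-point number $10^F\cdot n$ with $n$ in one decade. $\lfloor x\rfloor$ is the floor of the real number $x$. The values $m^*(E)$ are real numbers. A binade is an interval $[2^{s},2^{s+1})$ and a decade an interval $[10^{t},10^{t+1})$ with $s,t$ integers. The formula computes $F$ with one multiplication by the precomputed constant $\lfloor\log_{10}(2)\cdot 2^\lambda\rfloor$, a right shift by $\lambda$ bits, an added constant, and one comparison with a tabulated value $m^*(E)$. *)

theory Defs
  imports Complex_Main
begin

definition binade :: "int \<Rightarrow> real set" where
  "binade s = {2 powi s ..< 2 powi (s + 1)}"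

definition decade :: "int \<Rightarrow> real set" where
  "decade t = {10 powi t ..< 10 powi (t + 1)}"

(* The normalized binary mantissas of precision p2 fill the binade with index p2 - 1.
   Scaling by 2^k multiplies every mantissa by 2^k and replaces the exponent E0 by
   E0 - k; the case k = 0 is "no scaling". *)

definition scaled_binade :: "int \<Rightarrow> int \<Rightarrow> real set" where
  "scaled_binade p2 k = binade (p2 - 1 + k)"

definition scaled_exponents :: "int \<Rightarrow> int \<Rightarrow> int \<Rightarrow> int set" where
  "scaled_exponents Emin Emax k = {Emin - k .. Emax - k}"

definition mult_shift :: "int \<Rightarrow> int \<Rightarrow> int" where
  "mult_shift lam E =
     \<lfloor>real_of_int E * real_of_int \<lfloor>log 10 2 * 2 powi lam\<rfloor> * 2 powi (- lam)\<rfloor>"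

definition suitable_shift :: "int set \<Rightarrow> int \<Rightarrow> bool" where
  "suitable_shift R lam \<longleftrightarrow> (\<forall>E\<in>R. \<lfloor>real_of_int E * log 10 2\<rfloor> = mult_shift lam E)"

definition m_star :: "int \<Rightarrow> int \<Rightarrow> real" where
  "m_star l E =
     10 powr (1 - (real_of_int E * log 10 2 - real_of_int \<lfloor>real_of_int E * log 10 2\<rfloor>)
              + real_of_int l)"

definition decimal_exponent :: "int \<Rightarrow> real \<Rightarrow> int" where
  "decimal_exponent p10 x = \<lfloor>log 10 x\<rfloor> - p10 + 1"

end

theory Submission
  imports Defs
begin

text \<open>
  Since \<open>log 10 (2\<^sup>E * m) = E * log 10 2 + log 10 m\<close>, the floor is the sum of the two floors plus a
  carry, which occurs iff the fractional parts add up to at least 1, i.e. iff \<open>m\<close> reaches the threshold.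
  A suitable shift exists because \<open>E * log 10 2\<close> is not an integer for \<open>E \<noteq> 0\<close>: it lies in
  an open unit interval, which also contains \<open>E * c\<close> for every sufficiently accurate
  approximation \<open>c\<close> of \<open>log 10 2\<close>, and only finitely many \<open>E\<close> are involved.
\<close>

lemma log_powi:
  fixes b x :: real
  assumes "0 < x"
  shows "log b (x powi n) = of_int n * log b x"
  using assms by (metis log_powr less_le powr_real_of_int')

lemma floor_log10_of_decade:
  assumes "x \<in> decade l"
  shows "\<lfloor>log 10 x\<rfloor> = l"
proof -
  have "0 < (10::real) powi l"
    by simp
  then have "0 < x"
    using assms unfolding decade_def by (meson atLeastLessThan_iff less_le_trans)
  \<comment> \<open>\<open>decade\<close> uses integer powers, while the floor characterization of
    \<open>log\<close> is phrased with \<open>powr\<close>.\<close>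
  moreover have "(10::real) powi n = 10 powr of_int n" for n
    by (simp add: powr_real_of_int')
  ultimately show ?thesis
    using assms by (simp add: floor_log_eq_powr_iff decade_def)
qed

text \<open>An integer value n with E > 0 would give 2^E = 10^n, making 5 a divisor of a power of 2.
  Negative E reduces to this case by negating both sides.\<close>

lemma mult_log10_2_notin_Ints:
  fixes E :: int
  assumes "E \<noteq> 0"
  shows "of_int E * log 10 2 \<notin> \<int>"
proof -
  have pos: "of_int E * log 10 2 \<noteq> of_int n" if "E > 0" for E n :: int
  proof
    assume eq: "of_int E * log 10 2 = of_int n"
    \<comment> \<open>Positivity of n matters twice: 10^n becomes a natural power, and 5 divides it,
      which fails for 10^0.\<close>
    have "0 < of_int E * log 10 (2::real)"
      using that by simp
    with eq have "n > 0"
      by simp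
    have "(2::real) powr of_int E = (10 powr log 10 2) powr of_int E"
      by simp
    also have "\<dots> = 10 powr of_int n"
      by (simp only: powr_powr eq mult.commute)
    finally have "(2::real) ^ nat E = 10 ^ nat n"
      using that \<open>n > 0\<close> by (simp add: powr_real_of_int)
    then have "(2::nat) ^ nat E = 10 ^ nat n"
      by (metis of_nat_eq_iff of_nat_numeral of_nat_power)
    moreover have "(5::nat) dvd 10 ^ nat n"
      using \<open>n > 0\<close> by (intro dvd_trans[OF _ dvd_power]) auto
    ultimately have "(5::nat) dvd 2 ^ nat E"
      by simp
    moreover have "coprime (5::nat) 2"
      unfolding coprime_iff_gcd_eq_1 by (simp add: gcd_non_0_nat)
    then have "coprime (5::nat) (2 ^ nat E)"
      by simp
    ultimately show False
      using coprime_common_divisor[of "5::nat" "2 ^ nat E" 5] by simp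
  qed
  show ?thesis
  proof
    assume "of_int E * log 10 2 \<in> \<int>"
    then obtain n where n: "of_int E * log 10 2 = of_int n"
      by (auto elim: Ints_cases)
    then have "of_int (- E) * log 10 2 = of_int (- n)"
      by simp
    then show False
      using n pos[of E n] pos[of "- E" "- n"] assms by linarith
  qed
qed

text \<open>Truncating x after n binary digits loses less than 2^(-n), so the truncation is squeezed
  between x - 2^(-n) and x.\<close>

lemma floor_mult_power2_tendsto:
  fixes x :: real
  shows "(\<lambda>n. of_int \<lfloor>x * 2 ^ n\<rfloor> / 2 ^ n) \<longlonglongrightarrow> x"
proof (rule tendsto_sandwich)
  show "\<forall>\<^sub>F n in sequentially. x - (1/2) ^ n \<le> of_int \<lfloor>x * 2 ^ n\<rfloor> / 2 ^ n"
  proof (rule always_eventually, rule allI)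
    fix n
    have "x * 2 ^ n - 1 \<le> of_int \<lfloor>x * 2 ^ n\<rfloor>"
      by linarith
    then show "x - (1/2) ^ n \<le> of_int \<lfloor>x * 2 ^ n\<rfloor> / 2 ^ n"
      by (simp add: le_divide_eq left_diff_distrib flip: power_mult_distrib)
  qed
  show "\<forall>\<^sub>F n in sequentially. of_int \<lfloor>x * 2 ^ n\<rfloor> / 2 ^ n \<le> x"
    by (simp add: divide_le_eq)
  have "(\<lambda>n. x - (1/2) ^ n) \<longlonglongrightarrow> x - 0"
    by (intro tendsto_intros LIMSEQ_power_zero) simp
  then show "(\<lambda>n. x - (1/2) ^ n) \<longlonglongrightarrow> x"
    by simp
qed simp

text \<open>The floor is locally constant away from the integers. At an integer x, approximations
  from below would have floor x - 1.\<close>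

lemma eventually_floor_eq:
  fixes f :: "'a \<Rightarrow> real"
  assumes "(f \<longlongrightarrow> x) F" and "x \<notin> \<int>"
  shows "\<forall>\<^sub>F y in F. \<lfloor>f y\<rfloor> = \<lfloor>x\<rfloor>"
proof -
  have "of_int \<lfloor>x\<rfloor> < x"
    using assms(2) by (metis Ints_of_int of_int_floor_le order_le_less)
  moreover have "x < of_int \<lfloor>x\<rfloor> + 1"
    by linarith
  ultimately have "\<forall>\<^sub>F y in F. of_int \<lfloor>x\<rfloor> < f y \<and> f y < of_int \<lfloor>x\<rfloor> + 1"
    using assms(1) by (intro eventually_conj order_tendstoD)
  then show ?thesis
    by eventually_elim linarith
qed

lemma ex_suitable_shift:
  assumes "finite R"
  shows "\<exists>lam\<ge>0. suitable_shift R lam"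
proof -
  have "\<forall>\<^sub>F n in sequentially. \<lfloor>of_int E * log 10 2\<rfloor> = mult_shift (int n) E" for E
  \<comment> \<open>For E = 0 the product is an integer and the limit argument does not apply, but
    both sides are 0 for every shift.\<close>
  proof (cases "E = 0")
    case False
    \<comment> \<open>With shift n, \<open>mult_shift\<close> is the floor of this product, since
      \<open>2 powi (- int n)\<close> is division by 2^n.\<close>
    have "(\<lambda>n. of_int E * (of_int \<lfloor>log 10 2 * 2 ^ n\<rfloor> / 2 ^ n)) \<longlonglongrightarrow> of_int E * log 10 2"
      by (intro tendsto_mult_left floor_mult_power2_tendsto)
    from eventually_floor_eq[OF this mult_log10_2_notin_Ints[OF False]] show ?thesis
      by eventually_elim (simp add: mult_shift_def power_int_minus divide_inverse mult.assoc)
  qed (simp add: mult_shift_def)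
  \<comment> \<open>Finiteness of R turns the separate bounds on n for each E into one bound valid
    for all of R.\<close>
  then have "\<forall>\<^sub>F n in sequentially. suitable_shift R (int n)"
    unfolding suitable_shift_def using assms by (intro eventually_ball_finite) auto
  then obtain n where "suitable_shift R (int n)"
    using eventually_happens trivial_limit_sequentially by blast
  then show ?thesis
    by (intro exI[of _ "int n"]) simp
qed

lemma floor_log10_mult_powi:
  assumes "m > 0" and "\<lfloor>log 10 m\<rfloor> = l"
  shows "\<lfloor>log 10 (2 powi E * m)\<rfloor> =
    \<lfloor>of_int E * log 10 2\<rfloor> + l + (if m \<ge> m_star l E then 1 else 0)"
proof -
  have "log 10 (2 powi E * m) = of_int E * log 10 2 + log 10 m"
    using \<open>m > 0\<close> by (simp add: log_mult log_powi)
  \<comment> \<open>Taking logarithms undoes the power of ten in \<open>m_star\<close>. As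
    \<open>log 10 m\<close> minus l is a fractional part, the right side says that the two
    fractional parts sum to at least 1.\<close>
  moreover have "m \<ge> m_star l E \<longleftrightarrow>
      log 10 m \<ge> 1 - (of_int E * log 10 2 - of_int \<lfloor>of_int E * log 10 2\<rfloor>) + of_int l"
    using \<open>m > 0\<close> unfolding m_star_def by (subst le_log_iff) simp_all
  \<comment> \<open>Each fractional part is below 1, so their sum is below 2 and the carry is 0 or
    1.\<close>
  ultimately show ?thesis
    using assms(2) by (simp split: if_splits) linarith
qed

lemma mult_powi_mem_binade:
  assumes "x \<in> binade s"
  shows "x * 2 powi k \<in> binade (s + k)"
  using assms by (auto simp: binade_def power_int_add mult_ac)

theorem mainTheorem1:
  fixes p2 p10 Emin Emax :: int
  assumes "p2 \<ge> 1" and "p10 \<ge> 1"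
  shows
    "(\<exists>k. scaled_binade p2 k = {1..<2} \<and> scaled_binade p2 k \<subseteq> decade 0) \<and>
     (\<forall>k l. scaled_binade p2 k \<subseteq> decade l \<longrightarrow>
        (\<forall>x\<in>scaled_binade p2 k. \<lfloor>log 10 x\<rfloor> = l) \<and>
        (\<exists>lam\<ge>0. suitable_shift (scaled_exponents Emin Emax k) lam) \<and>
        (\<forall>lam. suitable_shift (scaled_exponents Emin Emax k) lam \<longrightarrow>
           (\<forall>E0\<in>{Emin..Emax}. \<forall>m0::int. real_of_int m0 \<in> binade (p2 - 1) \<longrightarrow>
              (let E = E0 - k; m = real_of_int m0 * 2 powi k in
                 E \<in> scaled_exponents Emin Emax k \<and>
                 m \<in> scaled_binade p2 k \<and>
                 2 powi E * m = 2 powi E0 * real_of_int m0 \<and>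
                 \<lfloor>log 10 m\<rfloor> = l \<and>
                 decimal_exponent p10 (2 powi E * m) =
                   mult_shift lam E + \<lfloor>log 10 m\<rfloor> - p10 + 1
                   + (if m \<ge> m_star l E then 1 else 0)))))"
proof -
  \<comment> \<open>The scaling 1 - p2 moves the binade index p2 - 1 + k to 0.\<close>
  have normalized: "scaled_binade p2 (1 - p2) = {1..<2}" "{1..<2::real} \<subseteq> decade 0"
    by (auto simp: scaled_binade_def binade_def decade_def)
  have scaled: "let E = E0 - k; m = real_of_int m0 * 2 powi k in
      E \<in> scaled_exponents Emin Emax k \<and>
      m \<in> scaled_binade p2 k \<and>
      2 powi E * m = 2 powi E0 * real_of_int m0 \<and>
      \<lfloor>log 10 m\<rfloor> = l \<and>
      decimal_exponent p10 (2 powi E * m) =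
        mult_shift lam E + \<lfloor>log 10 m\<rfloor> - p10 + 1 + (if m \<ge> m_star l E then 1 else 0)"
    if decade: "scaled_binade p2 k \<subseteq> decade l"
      and lam: "suitable_shift (scaled_exponents Emin Emax k) lam"
      and E0: "E0 \<in> {Emin..Emax}" and m0: "real_of_int m0 \<in> binade (p2 - 1)"
    for k l lam E0 m0
  proof -
    define E where "E = E0 - k"
    define m where "m = real_of_int m0 * 2 powi k"
    have E: "E \<in> scaled_exponents Emin Emax k"
      using E0 by (simp add: E_def scaled_exponents_def)
    have m: "m \<in> scaled_binade p2 k"
      unfolding m_def scaled_binade_def by (rule mult_powi_mem_binade[OF m0])
    have val: "2 powi E * m = 2 powi E0 * real_of_int m0"
      by (simp add: E_def m_def power_int_diff)
    have "0 < (2::real) powi (p2 - 1 + k)"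
      by simp
    then have "m > 0"
      using m unfolding scaled_binade_def binade_def by (meson atLeastLessThan_iff less_le_trans)
    have l: "\<lfloor>log 10 m\<rfloor> = l"
      using m decade by (blast intro: floor_log10_of_decade)
    \<comment> \<open>Suitability at the scaled exponent E, not at E0, lets the shifted product
      replace the exact floor.\<close>
    have "\<lfloor>of_int E * log 10 2\<rfloor> = mult_shift lam E"
      using lam E by (simp add: suitable_shift_def)
    then have "decimal_exponent p10 (2 powi E * m) =
        mult_shift lam E + \<lfloor>log 10 m\<rfloor> - p10 + 1 + (if m \<ge> m_star l E then 1 else 0)"
      using floor_log10_mult_powi[OF \<open>m > 0\<close> l, of E] l by (simp add: decimal_exponent_def)
    with E m val l show ?thesis
      unfolding Let_def E_def m_def by blast
  qed
  have shift: "\<exists>lam\<ge>0. suitable_shift (scaled_exponents Emin Emax k) lam" for k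
    by (rule ex_suitable_shift) (simp add: scaled_exponents_def)
  show ?thesis
  proof (intro conjI allI impI ballI)
    show "\<exists>k. scaled_binade p2 k = {1..<2} \<and> scaled_binade p2 k \<subseteq> decade 0"
      using normalized by (intro exI[of _ "1 - p2"]) simp
  qed (use shift scaled floor_log10_of_decade in blast)+
qed

end
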